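(* Let $(S,\nabla)$ be a divergence Kleene algebra and let $a,b\in S$ be such that $a$ d-quasi-commutes over $b$, i.e. $|b\rangle|a\rangle\le |a\rangle\,|(a+b)^*\rangle$. Then $a+b$ is Noetherian if and only if $a$ and $b$ are both Noetherian; equivalently, $\nabla(a+b)\le 0 \iff \nabla a+\nabla b\le 0$.
   Context: An idempotent semiring is a structure $(S,+,\cdot,0,1)$ such that $(S,+,0)$ is a commutative monoid with $a+a=a$, $(S,\cdot,1)$ is a monoid, multiplication distributes over addition from both sides, and $0a=a0=0$. Its natural order is $a\le b\iff a+b=b$. A test is an element $p\le 1$ for which some $q$ satisfies $p+q=1$ and $pq=0=qp$; this $q$ is unique and written $\neg p$. The tests form a Boolean algebra $\mathrm{test}(S)$ (join $+$, meet $\cdot$, complement $\neg$); $p-q=p\cdot\neg q$. $S$ is a modal semiring if for each $a\in S$ there are maps $|a\rangle,\langle a|:\mathrm{test}(S)\to\mathrm{test}(S)$ with, for all $a,b,p,q$: $|a\rangle p\le q\iff \neg q\,a\,p\le 0$; $\langle a|p\le q\iff p\,a\,\neg q\le 0$; $|ab\rangle p=|a\rangle(|b\rangle p)$; $\langle ab|p=\langle b|(\langle a|p)$. Maps on tests are ordered pointwise and juxtaposition denotes composition. A Kleene algebra is an idempotent semiring with ${}^*$ satisfying $1+aa^*\le a^*$, $b+ac\le c\Rightarrow a^*b\le c$, $1+a^*a\le a^*$, $b+ca\le c\Rightarrow ba^*\le c$. An element $a$ is Noetherian if for all tests $p$, $p-|a\rangle p\le 0$ implies $p\le 0$. For $a$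 in a modal semiring, a test $\nabla a$ is the divergence of $a$ if $\nabla a\le|a\rangle\nabla a$ and for every test $p$, $p\le |a\rangle p\Rightarrow p\le \nabla a$. A divergence Kleene algebra is a Kleene algebra that is a modal semiring in which $\nabla a$ exists for every $a$. *)

theory Defs
  imports Main
begin

(* The library class semiring_1 would force 0 to differ from 1, which is not required here. *)
class idem_semiring = semiring_0 + monoid_mult + ord +
  assumes add_idem: "a + a = a"
    and le_iff_add: "a \<le> b \<longleftrightarrow> a + b = b"
    and less_iff: "a < b \<longleftrightarrow> a \<le> b \<and> a \<noteq> b"
begin

subclass order
proof
  fix x y z :: 'a
  show "x < y \<longleftrightarrow> x \<le> y \<and> \<not> y \<le> x"
    by (metis less_iff le_iff_add add_idem add.commute)
  show "x \<le> x"
    by (simp add: le_iff_add add_idem)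
  show "x \<le> y \<Longrightarrow> y \<le> z \<Longrightarrow> x \<le> z"
    by (metis le_iff_add add.assoc)
  show "x \<le> y \<Longrightarrow> y \<le> x \<Longrightarrow> x = y"
    by (metis le_iff_add add.commute)
qed

definition is_complement :: "'a \<Rightarrow> 'a \<Rightarrow> bool" where
  "is_complement p q \<longleftrightarrow> p + q = 1 \<and> p * q = 0 \<and> q * p = 0"

definition test :: "'a \<Rightarrow> bool" where
  "test p \<longleftrightarrow> p \<le> 1 \<and> (\<exists>q. is_complement p q)"

lemma is_complement_unique:
  assumes "is_complement p q" and "is_complement p r"
  shows "q = r"
proof -
  have "q = q * (p + r)"
    using assms(2) by (simp add: is_complement_def)
  also have "\<dots> = q * r"
    using assms(1) by (simp only: distrib_left) (simp add: is_complement_def)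
  also have "\<dots> = (p + q) * r"
    using assms(2) by (simp only: distrib_right) (simp add: is_complement_def)
  also have "\<dots> = r"
    using assms(1) by (simp add: is_complement_def)
  finally show ?thesis .
qed

(* Meaningful only for tests, where the complement exists and is unique. *)
definition tneg :: "'a \<Rightarrow> 'a" where
  "tneg p = (THE q. is_complement p q)"

lemma is_complement_tneg:
  assumes "test p"
  shows "is_complement p (tneg p)"
  using assms is_complement_unique unfolding tneg_def test_def
  by (metis theI)

definition tdiff :: "'a \<Rightarrow> 'a \<Rightarrow> 'a" where
  "tdiff p q = p * tneg q"

end

(* The diamonds are maps on tests: fdia a p is |a>p and bdia a p is <a|p.
   Their values at arguments p that are not tests are unconstrained. *)
class modal_semiring = idem_semiring +
  fixes fdia :: "'a \<Rightarrow> 'a \<Rightarrow> 'a"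
    and bdia :: "'a \<Rightarrow> 'a \<Rightarrow> 'a"
  assumes test_fdia: "test p \<Longrightarrow> test (fdia a p)"
    and test_bdia: "test p \<Longrightarrow> test (bdia a p)"
    and fdia_le_iff: "test p \<Longrightarrow> test q \<Longrightarrow> fdia a p \<le> q \<longleftrightarrow> tneg q * a * p \<le> 0"
    and bdia_le_iff: "test p \<Longrightarrow> test q \<Longrightarrow> bdia a p \<le> q \<longleftrightarrow> p * a * tneg q \<le> 0"
    and fdia_mult: "test p \<Longrightarrow> fdia (a * b) p = fdia a (fdia b p)"
    and bdia_mult: "test p \<Longrightarrow> bdia (a * b) p = bdia b (bdia a p)"
begin

definition noetherian :: "'a \<Rightarrow> bool" where
  "noetherian a \<longleftrightarrow> (\<forall>p. test p \<longrightarrow> tdiff p (fdia a p) \<le> 0 \<longrightarrow> p \<le> 0)"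

definition is_divergence :: "'a \<Rightarrow> 'a \<Rightarrow> bool" where
  "is_divergence a d \<longleftrightarrow>
     test d \<and> d \<le> fdia a d \<and> (\<forall>p. test p \<longrightarrow> p \<le> fdia a p \<longrightarrow> p \<le> d)"

end

class kleene_algebra = idem_semiring +
  fixes star :: "'a \<Rightarrow> 'a"
  assumes star_unfoldl: "1 + a * star a \<le> star a"
    and star_inductl: "b + a * c \<le> c \<Longrightarrow> star a * b \<le> c"
    and star_unfoldr: "1 + star a * a \<le> star a"
    and star_inductr: "b + c * a \<le> c \<Longrightarrow> b * star a \<le> c"

class divergence_kleene_algebra = modal_semiring + kleene_algebra +
  fixes nabla :: "'a \<Rightarrow> 'a"
  assumes nabla_is_divergence: "is_divergence a (nabla a)"
begin

(* The inequality |b>|a> <= |a>|(a+b)*> between maps on tests, ordered pointwise. *)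
definition d_quasi_commutes :: "'a \<Rightarrow> 'a \<Rightarrow> bool" where
  "d_quasi_commutes a b \<longleftrightarrow>
     (\<forall>p. test p \<longrightarrow> fdia b (fdia a p) \<le> fdia a (fdia (star (a + b)) p))"

end

end

theory Submission
  imports Defs
begin

text \<open>
  Let \<open>d = \<nabla>(a + b)\<close>. As a fixpoint of \<open>|a + b\<rangle>\<close> it is closed under \<open>|(a + b)\<^sup>*\<rangle>\<close>, so quasi-commutation
  gives \<open>|b\<rangle>|a\<rangle>d \<le> |a\<rangle>d\<close>. Hence \<open>q = d - |a\<rangle>d\<close> satisfies \<open>q \<le> |b\<rangle>q\<close>: a \<open>b\<close>-step from \<open>q\<close> into \<open>d\<close>
  cannot end in \<open>|a\<rangle>d\<close>. If \<open>b\<close> is Noetherian then \<open>q = 0\<close>, that is \<open>d \<le> |a\<rangle>d\<close>, and if \<open>a\<close> is Noetherian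
  as well then \<open>d = 0\<close>.
\<close>

section \<open>Order and the Boolean algebra of tests\<close>

context idem_semiring
begin

lemma le_zero_iff: "x \<le> 0 \<longleftrightarrow> x = 0"
  by (simp add: le_iff_add)

lemma add_le_iff: "x + y \<le> z \<longleftrightarrow> x \<le> z \<and> y \<le> z"
  by (metis le_iff_add add_idem add.assoc add.commute)

lemma le_add1: "x \<le> x + y"
  using add_le_iff by blast

lemma le_add2: "y \<le> x + y"
  using add_le_iff by blast

lemma add_eq_zero_iff: "x + y = 0 \<longleftrightarrow> x = 0 \<and> y = 0"
  by (metis add_le_iff le_zero_iff)

lemma mult_mono_left: "x \<le> y \<Longrightarrow> z * x \<le> z * y"
  by (metis le_iff_add distrib_left)

lemma mult_mono_right: "x \<le> y \<Longrightarrow> x * z \<le> y * z"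
  by (metis le_iff_add distrib_right)

lemma test_le_one: "test p \<Longrightarrow> p \<le> 1"
  by (simp add: test_def)

lemma testI: "is_complement p q \<Longrightarrow> test p"
  unfolding test_def is_complement_def by (metis le_add1)

lemma is_complement_sym: "is_complement p q \<Longrightarrow> is_complement q p"
  by (simp add: is_complement_def add.commute)

lemma test_tneg: "test p \<Longrightarrow> test (tneg p)"
  using is_complement_tneg is_complement_sym testI by blast

lemma add_tneg: "test p \<Longrightarrow> p + tneg p = 1"
  and mult_tneg: "test p \<Longrightarrow> p * tneg p = 0"
  and tneg_mult: "test p \<Longrightarrow> tneg p * p = 0"
  using is_complement_tneg by (auto simp: is_complement_def)

lemma test_mult_le1: "test p \<Longrightarrow> x * p \<le> x"
  using mult_mono_left[OF test_le_one] by simp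

lemma test_mult_le2: "test p \<Longrightarrow> p * x \<le> x"
  using mult_mono_right[OF test_le_one] by simp

text \<open>Both products equal \<open>p * q * p\<close>: as \<open>q \<le> 1\<close>, the
  remainders \<open>p * q * tneg p\<close> and \<open>tneg p * q * p\<close> lie below
  \<open>p * tneg p\<close> and \<open>tneg p * p\<close>, so they vanish.\<close>

lemma test_mult_commute:
  assumes p: "test p" and q: "test q"
  shows "p * q = q * p"
proof -
  have "p * q * tneg p \<le> p * tneg p"
    using mult_mono_right[OF test_mult_le1[OF q]] .
  then have pqn: "p * q * tneg p = 0"
    using p by (simp add: mult_tneg le_zero_iff)
  have "tneg p * (q * p) \<le> tneg p * p"
    using mult_mono_left[OF test_mult_le2[OF q]] .
  then have nqp: "tneg p * (q * p) = 0"
    using p by (simp add: tneg_mult le_zero_iff)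
  have "p * q = p * q * (p + tneg p)"
    using p by (simp add: add_tneg)
  also have "\<dots> = p * q * p"
    unfolding distrib_left pqn by simp
  also have "\<dots> = (p + tneg p) * (q * p)"
    unfolding distrib_right nqp by (simp add: mult.assoc)
  also have "\<dots> = q * p"
    using p by (simp add: add_tneg)
  finally show ?thesis .
qed

lemma test_le_iff_mult_tneg:
  assumes p: "test p" and q: "test q"
  shows "p \<le> q \<longleftrightarrow> p * tneg q = 0"
proof
  assume "p \<le> q"
  then have "p * tneg q \<le> q * tneg q"
    by (rule mult_mono_right)
  then show "p * tneg q = 0"
    using q by (simp add: mult_tneg le_zero_iff)
next
  assume *: "p * tneg q = 0"
  have "p = p * (q + tneg q)"
    using q by (simp add: add_tneg)
  also have "\<dots> = p * q"
    unfolding distrib_left * by simp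
  also have "\<dots> \<le> q"
    using p by (rule test_mult_le2)
  finally show "p \<le> q" .
qed

lemma is_complement_add:
  assumes p: "test p" and q: "test q"
  shows "is_complement (p + q) (tneg p * tneg q)"
proof -
  note n = test_tneg[OF p] test_tneg[OF q]
  \<comment> \<open>The inserted summand \<open>tneg p * q\<close> is absorbed by \<open>q\<close>;
    it lets \<open>tneg p\<close> be factored out in front of \<open>q + tneg q = 1\<close>.\<close>
  have "p + q + tneg p * tneg q = p + (tneg p * q + q) + tneg p * tneg q"
    using test_mult_le2[OF n(1), of q] by (simp add: le_iff_add)
  also have "\<dots> = p + q + tneg p * (q + tneg q)"
    by (simp add: distrib_left add_ac)
  also have "\<dots> = q + (p + tneg p)"
    using q by (simp add: add_tneg add_ac)
  also have "\<dots> = 1"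
    using p test_le_one[OF q] by (simp add: add_tneg le_iff_add)
  finally have sum: "p + q + tneg p * tneg q = 1" .
  have "p * (tneg p * tneg q) = 0"
    using p by (simp add: mult.assoc[symmetric] mult_tneg)
  moreover have "q * (tneg p * tneg q) = 0"
    using q n by (simp add: test_mult_commute[of "tneg p"] mult.assoc[symmetric] mult_tneg)
  moreover have "tneg p * tneg q * q = 0"
    using q by (simp add: mult.assoc tneg_mult)
  moreover have "tneg p * tneg q * p = 0"
    using p n by (simp add: test_mult_commute[of "tneg p"] mult.assoc tneg_mult)
  ultimately show ?thesis
    using sum by (simp add: is_complement_def distrib_left distrib_right)
qed

lemma test_add: "test p \<Longrightarrow> test q \<Longrightarrow> test (p + q)"
  using is_complement_add testI by blast

lemma tneg_tneg: "test p \<Longrightarrow> tneg (tneg p) = p"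
  by (meson is_complement_tneg is_complement_sym is_complement_unique test_tneg)

text \<open>By De Morgan, \<open>p * q\<close> is the complement of \<open>tneg p + tneg q\<close>,
  so closure under sums carries over to products.\<close>

lemma test_mult: "test p \<Longrightarrow> test q \<Longrightarrow> test (p * q)"
  by (metis is_complement_add is_complement_sym testI test_tneg tneg_tneg)

lemma test_tdiff: "test p \<Longrightarrow> test q \<Longrightarrow> test (tdiff p q)"
  by (simp add: tdiff_def test_mult test_tneg)

text \<open>By De Morgan, both sides say \<open>p * tneg q * tneg r = 0\<close>.\<close>

lemma tdiff_le_iff:
  assumes p: "test p" and q: "test q" and r: "test r"
  shows "tdiff p q \<le> r \<longleftrightarrow> p \<le> q + r"
proof -
  have "tneg (q + r) = tneg q * tneg r"
    using q r by (meson is_complement_add is_complement_tneg is_complement_unique test_add)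
  then show ?thesis
    using p q r
    by (simp add: test_le_iff_mult_tneg test_tdiff test_add) (simp add: tdiff_def mult.assoc)
qed

lemma test_zero: "test 0"
  by (rule testI[of _ 1]) (simp add: is_complement_def)

lemma tdiff_le_zero_iff: "test p \<Longrightarrow> test q \<Longrightarrow> tdiff p q \<le> 0 \<longleftrightarrow> p \<le> q"
  by (simp add: tdiff_le_iff test_zero)

end

section \<open>Diamonds, divergence and Noetherian elements\<close>

context modal_semiring
begin

text \<open>The condition \<open>tneg q * x * p = 0\<close> is additive in \<open>x\<close>, and a
  sum vanishes only if both summands do. Comparing upper bounds among tests then shows that diamonds
  preserve sums.\<close>

lemma fdia_add_left_le_iff:
  "test p \<Longrightarrow> test q \<Longrightarrow> fdia (a + b) p \<le> q \<longleftrightarrow> fdia a p \<le> q \<and> fdia b p \<le> q"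
  by (simp add: fdia_le_iff le_zero_iff distrib_left distrib_right add_eq_zero_iff)

lemma fdia_add_right_le_iff:
  "test p \<Longrightarrow> test q \<Longrightarrow> test r \<Longrightarrow> fdia a (p + q) \<le> r \<longleftrightarrow> fdia a p \<le> r \<and> fdia a q \<le> r"
  by (simp add: fdia_le_iff test_add le_zero_iff distrib_left add_eq_zero_iff)

lemma fdia_add_left:
  assumes "test p"
  shows "fdia (a + b) p = fdia a p + fdia b p"
proof (rule order.antisym)
  show "fdia (a + b) p \<le> fdia a p + fdia b p"
    using assms by (simp add: fdia_add_left_le_iff test_add test_fdia le_add1 le_add2)
  show "fdia a p + fdia b p \<le> fdia (a + b) p"
    unfolding add_le_iff using assms
    by (metis fdia_add_left_le_iff order_refl test_fdia)
qed

lemma fdia_add_right: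
  assumes "test p" "test q"
  shows "fdia a (p + q) = fdia a p + fdia a q"
proof (rule order.antisym)
  show "fdia a (p + q) \<le> fdia a p + fdia a q"
    using assms by (simp add: fdia_add_right_le_iff test_add test_fdia le_add1 le_add2)
  show "fdia a p + fdia a q \<le> fdia a (p + q)"
    unfolding add_le_iff using assms
    by (metis fdia_add_right_le_iff order_refl test_fdia test_add)
qed

lemma fdia_mono: "test p \<Longrightarrow> test q \<Longrightarrow> p \<le> q \<Longrightarrow> fdia a p \<le> fdia a q"
  by (metis fdia_add_right le_iff_add)

lemma noetherian_iff: "noetherian a \<longleftrightarrow> (\<forall>p. test p \<longrightarrow> p \<le> fdia a p \<longrightarrow> p = 0)"
  unfolding noetherian_def by (metis tdiff_le_zero_iff test_fdia le_zero_iff)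

lemma noetherian_iff_divergence:
  assumes "is_divergence a d"
  shows "noetherian a \<longleftrightarrow> d = 0"
  using assms unfolding noetherian_iff is_divergence_def by (metis le_zero_iff)

text \<open>The Knaster-Tarski argument: by monotonicity \<open>fdia a d\<close> is again a
  postfixed point, hence below the greatest one.\<close>

lemma divergence_fixpoint:
  assumes "is_divergence a d"
  shows "fdia a d = d"
  using assms unfolding is_divergence_def by (meson order.antisym fdia_mono test_fdia)

text \<open>Since \<open>fdia a p\<close> and \<open>fdia b p\<close> lie below
  \<open>fdia (a + b) p\<close>, every postfixed point of a summand is one of the sum.\<close>

lemma noetherian_addD:
  assumes "noetherian (a + b)"
  shows "noetherian a" "noetherian b"
  using assms unfolding noetherian_iff
  by (metis fdia_add_left le_add1 le_add2 order_trans)+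

end

section \<open>Star induction and the divergence of a sum\<close>

context divergence_kleene_algebra
begin

text \<open>The hypothesis amounts to \<open>a * p = p * a * p\<close>, so
  \<open>a * p \<le> p * a\<close>. Star induction lifts this to
  \<open>star a * p \<le> p * star a\<close>, and \<open>tneg p\<close> annihilates the right-hand
  side.\<close>

lemma fdia_star_induct:
  assumes p: "test p" and le: "fdia a p \<le> p"
  shows "fdia (star a) p \<le> p"
proof -
  have 0: "tneg p * a * p = 0"
    using p le by (simp add: fdia_le_iff le_zero_iff)
  have "a * p = (p + tneg p) * (a * p)"
    using p by (simp add: add_tneg)
  also have "\<dots> = p * (a * p)"
    using 0 by (simp only: distrib_right mult.assoc) simp
  also have "\<dots> \<le> p * a"
    using p by (simp add: mult_mono_left test_mult_le1)
  finally have "a * p * star a \<le> p * a * star a"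
    by (rule mult_mono_right)
  \<comment> \<open>This prepares left star induction with \<open>p * star a\<close> as the prefixed
    point.\<close>
  then have "p + a * (p * star a) \<le> p * (1 + a * star a)"
    by (simp add: distrib_left mult.assoc add_le_iff le_add1)
      (metis le_add2 order_trans)
  also have "\<dots> \<le> p * star a"
    by (rule mult_mono_left) (rule star_unfoldl)
  finally have "star a * p \<le> p * star a"
    by (rule star_inductl)
  then have "tneg p * (star a * p) \<le> tneg p * (p * star a)"
    by (rule mult_mono_left)
  then have "tneg p * star a * p \<le> 0"
    using p by (simp add: mult.assoc[symmetric] tneg_mult)
  then show ?thesis
    using p by (simp add: fdia_le_iff)
qed

lemma noetherian_iff_nabla: "noetherian a \<longleftrightarrow> nabla a = 0"
  by (rule noetherian_iff_divergence) (rule nabla_is_divergence)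

lemma noetherian_add:
  assumes qc: "d_quasi_commutes a b" and a: "noetherian a" and b: "noetherian b"
  shows "noetherian (a + b)"
proof -
  define d where "d = nabla (a + b)"
  define e where "e = fdia a d"
  define q where "q = tdiff d e"
  have fixp: "fdia (a + b) d = d"
    unfolding d_def by (rule divergence_fixpoint) (rule nabla_is_divergence)
  have d: "test d"
    using nabla_is_divergence unfolding d_def is_divergence_def by blast
  have e: "test e" unfolding e_def using d by (rule test_fdia)
  have q: "test q" unfolding q_def using d e by (rule test_tdiff)
  have "fdia (star (a + b)) d \<le> d"
    using d fixp by (simp add: fdia_star_induct)
  then have "fdia a (fdia (star (a + b)) d) \<le> e"
    unfolding e_def using d by (simp add: fdia_mono test_fdia)
  then have be: "fdia b e \<le> e"
    using qc d unfolding d_quasi_commutes_def e_def by (meson order_trans)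
  \<comment> \<open>The Galois connection for \<open>tdiff\<close>, read at
    \<open>q \<le> q\<close>, covers \<open>d\<close> by \<open>e\<close> and
    \<open>q\<close>.\<close>
  have "d \<le> e + q"
    using d e q tdiff_le_iff q_def by blast
  then have "fdia b d \<le> fdia b e + fdia b q"
    using d e q by (metis fdia_mono fdia_add_right test_add)
  also have "\<dots> \<le> e + fdia b q"
    using be by (meson add_le_iff le_add1 le_add2 order_trans)
  \<comment> \<open>Adding \<open>e = fdia a d\<close> completes \<open>fdia b d\<close> to
    \<open>fdia (a + b) d\<close>, which is \<open>d\<close>.\<close>
  finally have "e + fdia b d \<le> e + fdia b q"
    by (simp add: add_le_iff le_add1)
  then have "d \<le> e + fdia b q"
    using fixp d unfolding e_def by (simp add: fdia_add_left)
  \<comment> \<open>The same Galois connection in the other direction moves \<open>e\<close> back to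
    the left.\<close>
  then have "q \<le> fdia b q"
    using d e q tdiff_le_iff test_fdia q_def by metis
  then have "q = 0"
    using b q by (simp add: noetherian_iff)
  then have "d \<le> e"
    using d e by (simp add: q_def flip: tdiff_le_zero_iff)
  then have "d = 0"
    using a d by (simp add: noetherian_iff e_def)
  then show ?thesis
    by (simp add: noetherian_iff_nabla d_def)
qed

end

theorem theorem10p6:
  fixes a b :: "'a :: divergence_kleene_algebra"
  assumes "d_quasi_commutes a b"
  shows "(noetherian (a + b) \<longleftrightarrow> noetherian a \<and> noetherian b) \<and>
         (nabla (a + b) \<le> 0 \<longleftrightarrow> nabla a + nabla b \<le> 0)"
proof -
  have "noetherian (a + b) \<longleftrightarrow> noetherian a \<and> noetherian b"
    using assms noetherian_add noetherian_addD by blast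
  then show ?thesis
    by (simp add: noetherian_iff_nabla le_zero_iff add_eq_zero_iff)
qed

end
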